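(* Let $n,k$ be positive integers. (i) If $n$ is not divisible by $k$, say $n=mk+j$ with $1\le j\le k-1$, then $$\mathrm{MPE}_n^k(t)=\mathrm{MPE}_{n,1}^k(t)=A_{m+1}(t)^{j}A_m(t)^{k-j}.$$ (ii) If $n$ is divisible by $k$, say $n=mk$, then $$\mathrm{MPE}_{n,r}^k(t)=\begin{cases}A_m(t)^k & \text{if } r=1,\\ t^{k+1-r}A_m(t)^k & \text{if } 2\le r\le k.\end{cases}$$
   Context: $\mathfrak{S}_n$ is the symmetric group on $[n]=\{1,\dots,n\}$, with $\pi=\pi_1\pi_2\cdots\pi_n$ in one-line notation. $\mathrm{exc}(\pi)=|\{i\in[n-1]:\pi_i>i\}|$ and $\mathrm{des}(\pi)=|\{i\in[n-1]:\pi_i>\pi_{i+1}\}|$. The Eulerian polynomial is $A_n(t)=\sum_{\pi\in\mathfrak{S}_n}t^{\mathrm{des}(\pi)}$, with $A_0(t)=1$. For a positive integer $k$ and $1\le r\le k$, $\mathrm{MP}_{n,r}^k$ is the set of $\pi\in\mathfrak{S}_n$ with $\pi_i-i\equiv r-1\pmod k$ for all $1\le i\le n$. The set of mod-$k$-alternating permutations is $\mathrm{MP}_n^k=\{\pi\in\mathfrak{S}_n:\pi_i\equiv i\pmod k\text{ for all }i\}=\mathrm{MP}_{n,1}^k$. $\mathrm{MPE}_{n,r}^k(t)=\sum_{\pi\in\mathrm{MP}_{n,r}^k}t^{\mathrm{exc}(\pi)}$, and $\mathrm{MPE}_n^k(t)$ denotes the same sum taken over $\mathrm{MP}_n^k$.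 *)

theory Defs
  imports
    "HOL-Combinatorics.Permutations"
    "HOL-Computational_Algebra.Polynomial"
    "HOL-Number_Theory.Cong"
begin

text \<open>
  The symmetric group on \<open>{1..n}\<close> is \<open>{p. p permutes {1..n}}\<close>, and the i-th letter of the one-line
  notation of \<open>p\<close> is \<open>p i\<close>. All generating functions are polynomials in a formal
  variable t with integer coefficients; t to the power e is \<open>monom 1 e\<close>.
\<close>

definition exc :: "nat \<Rightarrow> (nat \<Rightarrow> nat) \<Rightarrow> nat" where
  "exc n p = card {i \<in> {1..n - 1}. p i > i}"

definition des :: "nat \<Rightarrow> (nat \<Rightarrow> nat) \<Rightarrow> nat" where
  "des n p = card {i \<in> {1..n - 1}. p i > p (i + 1)}"

text \<open>For \<open>n = 0\<close> the sum has the single summand for the empty permutation, so that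
  \<open>eulerian_poly 0 = 1\<close>.\<close>

definition eulerian_poly :: "nat \<Rightarrow> int poly" where
  "eulerian_poly n = (\<Sum>p \<in> {p. p permutes {1..n}}. monom 1 (des n p))"

lemma eulerian_poly_0: "eulerian_poly 0 = 1"
  by (simp add: eulerian_poly_def des_def)

text \<open>The congruence is stated over the integers because \<open>p i - i\<close> may be negative.\<close>

definition MP_shift :: "nat \<Rightarrow> nat \<Rightarrow> nat \<Rightarrow> (nat \<Rightarrow> nat) set" where
  "MP_shift k n r =
     {p. p permutes {1..n} \<and> (\<forall>i\<in>{1..n}. [int (p i) - int i = int r - 1] (mod int k))}"

definition mod_alternating :: "nat \<Rightarrow> nat \<Rightarrow> (nat \<Rightarrow> nat) set" where
  "mod_alternating k n = {p. p permutes {1..n} \<and> (\<forall>i\<in>{1..n}. [p i = i] (mod k))}"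

definition MPE_shift :: "nat \<Rightarrow> nat \<Rightarrow> nat \<Rightarrow> int poly" where
  "MPE_shift k n r = (\<Sum>p \<in> MP_shift k n r. monom 1 (exc n p))"

definition MPE :: "nat \<Rightarrow> nat \<Rightarrow> int poly" where
  "MPE k n = (\<Sum>p \<in> mod_alternating k n. monom 1 (exc n p))"

end

theory Submission
  imports Defs
begin

text \<open>
  A permutation in \<open>MP_shift k n r\<close> sends each residue class modulo \<open>k\<close> bijectively onto the
  class shifted by \<open>r - 1\<close>, and these bijections can be chosen independently of each other. As the
  number of excedances is additive over the classes, the generating function is a product with one
  factor per class.

  The clean way to say this is with permanents. The excedance generating function over all
  permutations is the permanent of the matrix with entry t above the diagonal and 1 elsewhere.
  Replacing by 0 the entries that violate the congruence restricts the sum to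
  \<open>MP_shift k n r\<close>; what is left is a matrix that is block diagonal up to the order of its rows and
  columns, and its permanent is the product of the permanents of the blocks (\<open>permanent_blocks\<close>).

  A block has rows \<open>c, c + k, c + 2 k, ...\<close> and columns \<open>d, d + k, d + 2 k, ...\<close> with
  \<open>c, d < k\<close>. If \<open>d \<le> c\<close>, then \<open>c + k x < d + k y\<close> means \<open>x < y\<close>, and the block counts excedances;
  if \<open>c < d\<close>, it means \<open>x \<le> y\<close>, and the block counts weak excedances. For a
  nonempty block a cyclic shift of the values turns this into one further factor t (\<open>permanent_weak_exc_weight\<close>). For \<open>r = 1\<close> every block
  has \<open>c = d\<close>; for \<open>r > 1\<close> exactly \<open>k + 1 - r\<close> of the \<open>k\<close> blocks have \<open>c < d\<close>. Block sizes are
  \<open>m + 1\<close> for \<open>j\<close> of the classes and \<open>m\<close> for the others.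

  There remains the classical fact that excedances and descents are equidistributed
  (\<open>permanent_exc_weight\<close>). Here it is derived from a common recurrence. Both for inserting
  \<open>n + 1\<close> into a cycle and for inserting it into the word of a permutation of size \<open>n\<close> with
  statistic \<open>s\<close>, of the \<open>n + 1\<close> possible places \<open>s + 1\<close> leave the statistic unchanged and
  \<open>n - s\<close> raise it by one. Both generating functions therefore arise from 1 by the same sequence of
  linear operators \<open>eulerian_step n\<close>.
\<close>

section \<open>Permanents indexed by two sets\<close>

text \<open>
  Functions are required to be extensional so that a bijection between \<open>A\<close> and \<open>B\<close> is represented
  by exactly one function.
\<close>

definition bijections :: "'a set \<Rightarrow> 'b set \<Rightarrow> ('a \<Rightarrow> 'b) set" where
  "bijections A B = {f \<in> extensional A. bij_betw f A B}"

text \<open>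
  Rows and columns are indexed by different sets because a residue class of positions is in
  general paired with another residue class of values.
\<close>

definition permanent :: "('a \<Rightarrow> 'b \<Rightarrow> 'r::comm_semiring_1) \<Rightarrow> 'a set \<Rightarrow> 'b set \<Rightarrow> 'r" where
  "permanent w A B = (\<Sum>f\<in>bijections A B. \<Prod>i\<in>A. w i (f i))"

lemma bijections_subset_PiE: "bijections A B \<subseteq> A \<rightarrow>\<^sub>E B"
  by (auto simp: bijections_def PiE_def bij_betw_def)

lemma finite_bijections: "finite A \<Longrightarrow> finite B \<Longrightarrow> finite (bijections A B)"
  by (rule finite_subset[OF bijections_subset_PiE]) (auto intro: finite_PiE)

lemma permanent_cong:
  assumes "A = A'" "B = B'" and "\<And>i j. i \<in> A \<Longrightarrow> j \<in> B \<Longrightarrow> w i j = w' i j"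
  shows "permanent w A B = permanent w' A' B'"
  using assms bijections_subset_PiE[of A B] unfolding permanent_def
  by (intro sum.cong prod.cong) auto

lemma permanent_permutes:
  "permanent w S S = (\<Sum>p | p permutes S. \<Prod>i\<in>S. w i (p i))"
  unfolding permanent_def
proof (rule sum.reindex_bij_witness[where i = "\<lambda>p. restrict p S"
      and j = "\<lambda>f i. if i \<in> S then f i else i"])
  fix f assume "f \<in> bijections S S"
  then have f: "f \<in> extensional S" "bij_betw f S S" by (auto simp: bijections_def)
  then show "restrict (\<lambda>i. if i \<in> S then f i else i) S = f"
    by (auto simp: restrict_def extensional_def fun_eq_iff)
  have "bij_betw (\<lambda>i. if i \<in> S then f i else i) S S"
    using f(2) by (simp cong: bij_betw_cong)
  then show "(\<lambda>i. if i \<in> S then f i else i) \<in> {p. p permutes S}"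
    by (simp add: bij_imp_permutes)
  show "(\<Prod>i\<in>S. w i (if i \<in> S then f i else i)) = (\<Prod>i\<in>S. w i (f i))"
    by (rule prod.cong) auto
next
  fix p assume "p \<in> {p. p permutes S}"
  then have p: "p permutes S" by simp
  show "(\<lambda>i. if i \<in> S then restrict p S i else i) = p"
    using permutes_not_in[OF p] by auto
  show "restrict p S \<in> bijections S S"
    using permutes_imp_bij[OF p] by (auto simp: bijections_def cong: bij_betw_cong)
qed

lemma permanent_reindex:
  assumes h: "inj_on h A" and g: "inj_on g B"
  shows "permanent w (h ` A) (g ` B) = permanent (\<lambda>x y. w (h x) (g y)) A B"
  unfolding permanent_def
proof (rule sum.reindex_bij_witness[
      where j = "\<lambda>f. \<lambda>x\<in>A. the_inv_into B g (f (h x))"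
        and i = "\<lambda>f. \<lambda>u\<in>h ` A. g (f (the_inv_into A h u))"])
  have bh: "bij_betw h A (h ` A)" and bg: "bij_betw g B (g ` B)"
    using h g by (auto simp: bij_betw_def)
  note bh' = bij_betw_the_inv_into[OF bh] and bg' = bij_betw_the_inv_into[OF bg]
  {
    fix f assume "f \<in> bijections (h ` A) (g ` B)"
    then have f: "f \<in> extensional (h ` A)" "bij_betw f (h ` A) (g ` B)"
      by (auto simp: bijections_def)
    have fx: "f (h x) \<in> g ` B" if "x \<in> A" for x
      using f(2) that by (auto simp: bij_betw_def)
    show "(\<lambda>u\<in>h ` A. g ((\<lambda>x\<in>A. the_inv_into B g (f (h x))) (the_inv_into A h u))) = f"
    proof (rule extensionalityI[OF restrict_extensional f(1)])
      fix u assume "u \<in> h ` A"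
      then show "(\<lambda>u\<in>h ` A. g ((\<lambda>x\<in>A. the_inv_into B g (f (h x))) (the_inv_into A h u))) u = f u"
        using fx by (auto simp: the_inv_into_f_f[OF h] f_the_inv_into_f[OF g])
    qed
    have "bij_betw (the_inv_into B g \<circ> (f \<circ> h)) A B"
      using bij_betw_trans[OF bij_betw_trans[OF bh f(2)] bg'] by (simp add: comp_assoc)
    then show "(\<lambda>x\<in>A. the_inv_into B g (f (h x))) \<in> bijections A B"
      by (auto simp: bijections_def o_def cong: bij_betw_cong)
    show "(\<Prod>i\<in>A. w (h i) (g ((\<lambda>x\<in>A. the_inv_into B g (f (h x))) i))) = (\<Prod>i\<in>h ` A. w i (f i))"
      using fx by (simp add: prod.reindex[OF h] f_the_inv_into_f[OF g])
  next
    fix f assume "f \<in> bijections A B"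
    then have f: "f \<in> extensional A" "bij_betw f A B"
      by (auto simp: bijections_def)
    have fx: "f x \<in> B" if "x \<in> A" for x
      using f(2) that by (auto simp: bij_betw_def)
    show "(\<lambda>x\<in>A. the_inv_into B g ((\<lambda>u\<in>h ` A. g (f (the_inv_into A h u))) (h x))) = f"
    proof (rule extensionalityI[OF restrict_extensional f(1)])
      fix x assume "x \<in> A"
      then show "(\<lambda>x\<in>A. the_inv_into B g ((\<lambda>u\<in>h ` A. g (f (the_inv_into A h u))) (h x))) x = f x"
        using fx by (auto simp: the_inv_into_f_f[OF h] the_inv_into_f_f[OF g])
    qed
    have "bij_betw (g \<circ> (f \<circ> the_inv_into A h)) (h ` A) (g ` B)"
      using bij_betw_trans[OF bij_betw_trans[OF bh' f(2)] bg] by (simp add: comp_assoc)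
    then show "(\<lambda>u\<in>h ` A. g (f (the_inv_into A h u))) \<in> bijections (h ` A) (g ` B)"
      by (auto simp: bijections_def o_def cong: bij_betw_cong)
  }
qed

text \<open>
  Here \<open>r\<close> and \<open>c\<close> assign a block to each row and each column. A bijection with a nonzero product
  respects the blocks. It maps each row block onto, and not just into, the column block of the same
  name, because the column blocks are disjoint and every column is hit. Distributing the product of
  sums over the choice of one bijection per block gives the claim, also when a row block and its column
  block differ in size and both sides vanish.
\<close>

lemma permanent_blocks:
  assumes fin: "finite A" "finite B" "finite C"
    and r: "\<And>i. i \<in> A \<Longrightarrow> r i \<in> C" and c: "\<And>j. j \<in> B \<Longrightarrow> c j \<in> C"
    and zero: "\<And>i j. i \<in> A \<Longrightarrow> j \<in> B \<Longrightarrow> r i \<noteq> c j \<Longrightarrow> w i j = 0"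
  shows "permanent w A B = (\<Prod>d\<in>C. permanent w {i \<in> A. r i = d} {j \<in> B. c j = d})"
proof -
  define D E where "D = (\<lambda>d. {i \<in> A. r i = d})" and "E = (\<lambda>d. {j \<in> B. c j = d})"
  define F where "F = {f \<in> bijections A B. \<forall>i\<in>A. c (f i) = r i}"
  have "permanent w A B = (\<Sum>f\<in>F. \<Prod>i\<in>A. w i (f i))"
    unfolding permanent_def
  proof (rule sum.mono_neutral_right)
    show "finite (bijections A B)" using fin by (simp add: finite_bijections)
    show "F \<subseteq> bijections A B" by (auto simp: F_def)
    show "\<forall>f\<in>bijections A B - F. (\<Prod>i\<in>A. w i (f i)) = 0"
    proof
      fix f assume f: "f \<in> bijections A B - F"
      then obtain i where "i \<in> A" "c (f i) \<noteq> r i" by (auto simp: F_def)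
      moreover have "f i \<in> B" using f \<open>i \<in> A\<close> bijections_subset_PiE[of A B] by auto
      ultimately have "w i (f i) = 0" by (intro zero) auto
      then show "(\<Prod>i\<in>A. w i (f i)) = 0" using \<open>i \<in> A\<close> fin by (intro prod_zero) auto
    qed
  qed
  \<comment> \<open>A block-respecting bijection is the same as a family of bijections, one for each block.\<close>
  also have "\<dots> = (\<Sum>G\<in>Pi\<^sub>E C (\<lambda>d. bijections (D d) (E d)). \<Prod>d\<in>C. \<Prod>i\<in>D d. w i (G d i))"
  proof (rule sum.reindex_bij_witness[where i = "\<lambda>G. \<lambda>i\<in>A. G (r i) i"
        and j = "\<lambda>f. \<lambda>d\<in>C. restrict f (D d)"])
    fix f assume "f \<in> F"
    then have ext: "f \<in> extensional A" and bij: "bij_betw f A B"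
      and cl: "\<And>i. i \<in> A \<Longrightarrow> c (f i) = r i"
      by (auto simp: F_def bijections_def)
    show "(\<lambda>i\<in>A. (\<lambda>d\<in>C. restrict f (D d)) (r i) i) = f"
      by (rule extensionalityI[OF restrict_extensional ext]) (auto simp: r D_def)
    have "bij_betw f (D d) (E d)" for d
    proof (rule bij_betw_subset[OF bij])
      show "D d \<subseteq> A" by (auto simp: D_def)
      show "f ` D d = E d"
        using bij cl unfolding D_def E_def bij_betw_def by auto
    qed
    then show "(\<lambda>d\<in>C. restrict f (D d)) \<in> Pi\<^sub>E C (\<lambda>d. bijections (D d) (E d))"
      by (auto simp: bijections_def cong: bij_betw_cong)
    have "(\<Prod>d\<in>C. \<Prod>i\<in>D d. w i ((\<lambda>d\<in>C. restrict f (D d)) d i)) = (\<Prod>d\<in>C. \<Prod>i\<in>D d. w i (f i))"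
      by (intro prod.cong) auto
    also have "\<dots> = (\<Prod>i\<in>A. w i (f i))"
      unfolding D_def using fin r by (intro prod.group) auto
    finally show "(\<Prod>d\<in>C. \<Prod>i\<in>D d. w i ((\<lambda>d\<in>C. restrict f (D d)) d i)) = (\<Prod>i\<in>A. w i (f i))" .
  next
    fix G assume G: "G \<in> Pi\<^sub>E C (\<lambda>d. bijections (D d) (E d))"
    have bij: "bij_betw (G d) (D d) (E d)" "G d \<in> extensional (D d)" if "d \<in> C" for d
      using G that by (auto simp: bijections_def)
    have GE: "G (r i) i \<in> E (r i)" if "i \<in> A" for i
      using bij(1)[OF r[OF that]] that unfolding bij_betw_def D_def by auto
    show "(\<lambda>d\<in>C. restrict (\<lambda>i\<in>A. G (r i) i) (D d)) = G"
    proof (rule extensionalityI[OF restrict_extensional])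
      show "G \<in> extensional C" using G by (simp add: PiE_iff)
      fix d assume d: "d \<in> C"
      have "restrict (\<lambda>i\<in>A. G (r i) i) (D d) = G d"
        by (rule extensionalityI[OF restrict_extensional bij(2)[OF d]]) (auto simp: D_def)
      then show "(\<lambda>d\<in>C. restrict (\<lambda>i\<in>A. G (r i) i) (D d)) d = G d" using d by simp
    qed
    have "inj_on (\<lambda>i. G (r i) i) A"
    proof (rule inj_onI)
      fix i i' assume i: "i \<in> A" "i' \<in> A" and eq: "G (r i) i = G (r i') i'"
      have "r i = r i'" using GE[OF i(1)] GE[OF i(2)] eq by (auto simp: E_def)
      then show "i = i'"
        using bij(1)[OF r[OF i(1)]] i eq unfolding bij_betw_def inj_on_def D_def by auto
    qed
    moreover have "(\<lambda>i. G (r i) i) ` A = B"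
    proof (intro equalityI subsetI)
      fix j assume "j \<in> (\<lambda>i. G (r i) i) ` A"
      then show "j \<in> B" using GE by (auto simp: E_def)
    next
      fix j assume j: "j \<in> B"
      then have "j \<in> G (c j) ` D (c j)"
        using bij(1)[OF c[OF j]] by (auto simp: bij_betw_def E_def)
      then obtain i where "i \<in> A" "r i = c j" "j = G (c j) i" by (auto simp: D_def)
      then show "j \<in> (\<lambda>i. G (r i) i) ` A" by (intro image_eqI[where x = i]) auto
    qed
    ultimately have "bij_betw (\<lambda>i. G (r i) i) A B" by (simp add: bij_betw_def)
    then show "(\<lambda>i\<in>A. G (r i) i) \<in> F"
      using GE by (auto simp: F_def bijections_def E_def cong: bij_betw_cong)
  qed
  also have "\<dots> = (\<Prod>d\<in>C. permanent w (D d) (E d))"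
    unfolding permanent_def D_def E_def
    using fin by (subst prod_sum_PiE) (auto intro: finite_bijections)
  finally show ?thesis by (simp add: D_def E_def)
qed

section \<open>The Eulerian recurrence\<close>

text \<open>
  The operator sends \<open>t^s\<close> to \<open>(s + 1) t^s + (n - s) t^(s + 1)\<close>; the derivative supplies the
  factor \<open>s\<close> linearly in the polynomial.
\<close>

definition eulerian_step :: "nat \<Rightarrow> int poly \<Rightarrow> int poly" where
  "eulerian_step n q = (1 + monom (int n) 1) * q + (monom 1 1 - monom 1 2) * pderiv q"

lemma eulerian_step_sum: "eulerian_step n (sum f S) = (\<Sum>s\<in>S. eulerian_step n (f s))"
  by (simp add: eulerian_step_def sum_distrib_left sum.distrib higher_pderiv_sum[where n = 1, simplified])

text \<open>
  Of the \<open>n + 1\<close> places where a new largest letter can be inserted, one never changes the statistic.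
  The others are indexed by \<open>v < n\<close>, and \<open>U\<close> is the set of those that carry a descent or an
  excedance already: inserting there destroys it and creates a new one.
\<close>

lemma eulerian_step_monom:
  assumes U: "U \<subseteq> {..<n}"
  shows "eulerian_step n (monom 1 (card U)) =
    monom 1 (card U) + (\<Sum>v<n. monom 1 (if v \<in> U then card U else Suc (card U)))"
proof -
  let ?d = "card U"
  have fin: "finite U" using U finite_subset by blast
  have "(\<Sum>v<n. monom 1 (if v \<in> U then ?d else Suc ?d)) =
      (\<Sum>v<n. if v \<in> U then monom 1 ?d else monom 1 (Suc ?d) :: int poly)"
    by (intro sum.cong) auto
  also have "\<dots> = (\<Sum>v\<in>{..<n} \<inter> U. monom 1 ?d) + (\<Sum>v\<in>{..<n} \<inter> - U. monom 1 (Suc ?d))"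
    by (subst sum.If_cases) auto
  also have "{..<n} \<inter> U = U" using U by auto
  also have "card ({..<n} \<inter> - U) = n - ?d"
    using U fin by (metis Diff_eq card_Diff_subset card_lessThan)
  then have "(\<Sum>v\<in>{..<n} \<inter> - U. monom 1 (Suc ?d)) = monom (int n - int ?d) (Suc ?d)"
    using card_mono[OF _ U] by (simp add: of_nat_poly smult_monom of_nat_diff)
  also have "(\<Sum>v\<in>U. monom 1 ?d) = monom (int ?d) ?d"
    by (simp add: of_nat_poly smult_monom)
  finally have S: "(\<Sum>v<n. monom 1 (if v \<in> U then ?d else Suc ?d)) =
    monom (int ?d) ?d + monom (int n - int ?d) (Suc ?d)" .
  show ?thesis unfolding S eulerian_step_def
    by (cases ?d) (auto simp: pderiv_monom algebra_simps mult_monom add_monom diff_monom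
        eval_nat_numeral)
qed

section \<open>Descents\<close>

text \<open>
  The word of \<open>p \<circ> insert_at n j\<close> is that of \<open>p\<close> with the letter \<open>n + 1\<close> inserted at position
  \<open>j\<close>, as \<open>p\<close> itself fixes \<open>n + 1\<close>.
\<close>

definition insert_at :: "nat \<Rightarrow> nat \<Rightarrow> nat \<Rightarrow> nat" where
  "insert_at n j i = (if i < j \<or> i > Suc n then i else if i = j then Suc n else i - 1)"

lemma insert_at_permutes:
  assumes "j \<in> {1..Suc n}"
  shows "insert_at n j permutes {1..Suc n}"
proof (rule bij_imp_permutes)
  show "bij_betw (insert_at n j) {1..Suc n} {1..Suc n}"
    by (rule bij_betw_byWitness[where f' = "\<lambda>i. if i < j then i else if i = Suc n then j else Suc i"])
      (use assms in \<open>auto simp: insert_at_def split: if_splits\<close>)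
qed (use assms in \<open>auto simp: insert_at_def\<close>)

lemma permutes_Suc_fixed:
  assumes "p permutes {1..n}"
  shows "p permutes {1..Suc n}" "p (Suc n) = Suc n"
  using permutes_subset[OF assms, of "{1..Suc n}"] permutes_not_in[OF assms, of "Suc n"] by auto

text \<open>
  The position of the letter \<open>n + 1\<close> determines \<open>j\<close>, and cancelling the permutation
  \<open>insert_at n j\<close> recovers \<open>p\<close>.
\<close>

lemma bij_betw_insert_at:
  "bij_betw (\<lambda>(p, j). p \<circ> insert_at n j) ({p. p permutes {1..n}} \<times> {1..Suc n})
     {p. p permutes {1..Suc n}}"
  unfolding bij_betw_def
proof
  show "inj_on (\<lambda>(p, j). p \<circ> insert_at n j) ({p. p permutes {1..n}} \<times> {1..Suc n})"
  proof (rule inj_onI, clarify)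
    fix p j p' j'
    assume p: "p permutes {1..n}" "p' permutes {1..n}"
      and j: "j \<in> {1..Suc n}" "j' \<in> {1..Suc n}"
      and eq: "p \<circ> insert_at n j = p' \<circ> insert_at n j'"
    note P = permutes_Suc_fixed[OF p(1)] permutes_Suc_fixed[OF p(2)]
    have "p' (insert_at n j' j) = p (insert_at n j j)"
      using eq by (metis comp_apply)
    also have "\<dots> = p' (Suc n)" using j P by (simp add: insert_at_def)
    finally have "insert_at n j' j = Suc n"
      using permutes_inj[OF p(2)] by (simp add: inj_eq)
    then have "j = j'" using j by (auto simp: insert_at_def split: if_splits)
    moreover from this have "p = p'"
      using eq permutes_surj[OF insert_at_permutes[OF j(1)]] by (metis surj_fun_eq)
    ultimately show "p = p' \<and> j = j'" by simp
  qed
  show "(\<lambda>(p, j). p \<circ> insert_at n j) ` ({p. p permutes {1..n}} \<times> {1..Suc n}) =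
    {p. p permutes {1..Suc n}}" (is "?L = ?R")
  proof (intro equalityI subsetI)
    fix q assume "q \<in> ?L"
    then show "q \<in> ?R"
      using permutes_compose[OF insert_at_permutes permutes_Suc_fixed(1)] by auto
  next
    fix q assume "q \<in> ?R"
    then have q: "q permutes {1..Suc n}" by simp
    define j where "j = inv q (Suc n)"
    have qj: "q j = Suc n" by (simp add: j_def permutes_inverses[OF q])
    then have j: "j \<in> {1..Suc n}"
      using permutes_in_image[OF q, of j] by simp
    note ins = insert_at_permutes[OF j]
    define p where "p = q \<circ> inv (insert_at n j)"
    have "p permutes {1..Suc n}"
      unfolding p_def by (rule permutes_compose[OF permutes_inv[OF ins] q])
    moreover have "inv (insert_at n j) (Suc n) = j"
      using permutes_inverses(2)[OF ins, of j] j by (simp add: insert_at_def)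
    then have "p (Suc n) = Suc n" by (simp add: p_def qj)
    ultimately have "p permutes {1..n}"
      by (rule_tac permutes_superset[where S = "{1..Suc n}"]) (auto simp: le_Suc_eq)
    moreover have "q = p \<circ> insert_at n j"
      by (auto simp: p_def fun_eq_iff permutes_inverses[OF ins])
    ultimately show "q \<in> ?L" using j by auto
  qed
qed

definition descents :: "nat \<Rightarrow> (nat \<Rightarrow> nat) \<Rightarrow> nat set" where
  "descents n p = {i \<in> {1..n - 1}. p i > p (i + 1)}"

text \<open>
  The letter \<open>n + 1\<close> is placed between the letters \<open>j\<close> and \<open>j + 1\<close> of \<open>p\<close>. The pair formed by
  them disappears; the new pair on the left is an ascent and the new pair on the right, present unless
  \<open>j = n\<close>, is a descent.
\<close>

lemma des_insert_at:
  assumes p: "p permutes {1..n}" and j: "j \<le> n"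
  shows "des (Suc n) (p \<circ> insert_at n (Suc j)) =
    (if j = n \<or> j \<in> descents n p then des n p else Suc (des n p))"
proof -
  let ?D = "descents n p"
  have le: "p i \<le> n" if "i \<le> n" for i
    using permutes_in_image[OF p, of i] permutes_not_in[OF p, of i] that by (cases "i = 0") auto
  have top: "p (Suc n) = Suc n" by (rule permutes_Suc_fixed[OF p])
  have fin: "finite ?D" by (simp add: descents_def)
  have D: "i \<in> ?D \<longleftrightarrow> 1 \<le> i \<and> i < n \<and> p (i + 1) < p i" for i by (auto simp: descents_def)
  let ?L = "{i \<in> ?D. i < j}" and ?R = "{i \<in> ?D. j < i}"
  have "descents (Suc n) (p \<circ> insert_at n (Suc j)) = ?L \<union> (if j = n then {} else {Suc j}) \<union> Suc ` ?R"
    (is "?l = ?r")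
  proof (rule set_eqI)
    fix i
    consider "i = 0" | "1 \<le> i" "i < j" | "1 \<le> i" "i = j" | "i = Suc j" "i \<le> n"
      | i' where "i = Suc i'" "j < i'" "i' < n" | "i > n"
    proof -
      have "i = 0 \<or> (1 \<le> i \<and> i < j) \<or> (1 \<le> i \<and> i = j) \<or> (i = Suc j \<and> i \<le> n)
        \<or> (i = Suc (i - 1) \<and> j < i - 1 \<and> i - 1 < n) \<or> i > n" by linarith
      then show ?thesis using that by blast
    qed
    then show "i \<in> ?l \<longleftrightarrow> i \<in> ?r"
    proof cases
      case 3
      then show ?thesis using j le[of i] top
        by (auto simp: descents_def insert_at_def image_iff)
    next
      case 4
      then show ?thesis using j le[of i] top
        by (auto simp: descents_def insert_at_def image_iff)
    qed (use j in \<open>auto simp: descents_def insert_at_def image_iff\<close>)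
  qed
  then have "des (Suc n) (p \<circ> insert_at n (Suc j)) =
      card (?L \<union> (if j = n then {} else {Suc j}) \<union> Suc ` ?R)"
    by (simp add: des_def descents_def)
  also have "\<dots> = card (?L \<union> (if j = n then {} else {Suc j})) + card (Suc ` ?R)"
    using fin by (intro card_Un_disjoint) auto
  also have "card (?L \<union> (if j = n then {} else {Suc j})) = card ?L + (if j = n then 0 else 1)"
    using fin by (auto simp: card_insert_if)
  also have "card (Suc ` ?R) = card ?R" by (simp add: card_image)
  also have "card ?L + (if j = n then 0 else 1) + card ?R = card (?L \<union> ?R) + (if j = n then 0 else 1)"
    using fin by (subst card_Un_disjoint) auto
  also have "?L \<union> ?R = ?D - {j}" by auto
  also have "card (?D - {j}) + (if j = n then 0 else 1) =
      (if j = n \<or> j \<in> ?D then card ?D else Suc (card ?D))"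
    using fin D[of j] card_gt_0_iff[of ?D] by (auto simp: card_Diff_singleton_if)
  finally show ?thesis by (simp add: des_def descents_def)
qed

lemma eulerian_poly_Suc: "eulerian_poly (Suc n) = eulerian_step n (eulerian_poly n)"
proof -
  have "eulerian_poly (Suc n) =
    (\<Sum>x\<in>{p. p permutes {1..n}} \<times> {1..Suc n}. monom 1 (des (Suc n) (fst x \<circ> insert_at n (snd x))))"
    unfolding eulerian_poly_def
    by (subst sum.reindex_bij_betw[OF bij_betw_insert_at, symmetric]) (simp add: case_prod_unfold)
  also have "\<dots> = (\<Sum>p | p permutes {1..n}. \<Sum>j\<in>{1..Suc n}. monom 1 (des (Suc n) (p \<circ> insert_at n j)))"
    by (subst sum.Sigma) (auto simp: finite_permutations case_prod_unfold)
  also have "\<dots> = (\<Sum>p | p permutes {1..n}. eulerian_step n (monom 1 (des n p)))"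
  proof (rule sum.cong[OF refl], safe)
    fix p assume p: "p permutes {1..n}"
    let ?D = "descents n p"
    have des: "des n p = card ?D" by (simp add: des_def descents_def)
    have "(\<Sum>j\<in>{1..Suc n}. monom 1 (des (Suc n) (p \<circ> insert_at n j)) :: int poly) =
      (\<Sum>j<Suc n. monom 1 (des (Suc n) (p \<circ> insert_at n (Suc j))))"
      by (rule sum.reindex_bij_witness[where i = Suc and j = "\<lambda>j. j - 1"]) auto
    also have "\<dots> = (\<Sum>j<n. monom 1 (if j \<in> ?D then card ?D else Suc (card ?D))) + monom 1 (card ?D)"
      unfolding des[symmetric] by (simp add: des_insert_at[OF p])
    also have "\<dots> = eulerian_step n (monom 1 (des n p))"
      unfolding des by (subst eulerian_step_monom) (auto simp: descents_def)
    finally show "(\<Sum>j\<in>{1..Suc n}. monom 1 (des (Suc n) (p \<circ> insert_at n j))) =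
      eulerian_step n (monom 1 (des n p))" .
  qed
  also have "\<dots> = eulerian_step n (eulerian_poly n)"
    by (simp add: eulerian_poly_def eulerian_step_sum)
  finally show ?thesis .
qed

section \<open>Excedances and weak excedances\<close>

definition exc_weight :: "nat \<Rightarrow> nat \<Rightarrow> int poly" where
  "exc_weight i j = (if i < j then monom 1 1 else 1)"

lemma prod_exc_weight:
  "finite S \<Longrightarrow> (\<Prod>i\<in>S. exc_weight i (f i)) = monom 1 (card {i \<in> S. i < f i})"
  by (simp add: exc_weight_def prod.If_cases monom_power Int_def)

text \<open>
  Composing \<open>p\<close> with the transposition of \<open>n\<close> and \<open>p v\<close> inserts \<open>n\<close> into the cycle of \<open>v\<close>,
  right after \<open>v\<close>: then \<open>v\<close> is mapped to \<open>n\<close>, which makes it an excedance in any case, and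
  \<open>n\<close> is mapped to the former \<open>p v\<close>. The remaining choice, \<open>n\<close> as a fixed point, changes no
  excedance. The sum over \<open>b\<close> is rewritten as a sum over \<open>v\<close> with \<open>b = p v\<close>.
\<close>

lemma permanent_exc_weight_Suc:
  "permanent exc_weight {..<Suc n} {..<Suc n} =
     eulerian_step n (permanent exc_weight {..<n} {..<n})"
proof -
  let ?X = "\<lambda>n p. {i \<in> {..<n}. i < p i}"
  have perm: "permanent exc_weight {..<m} {..<m} = (\<Sum>p | p permutes {..<m}. monom 1 (card (?X m p)))" for m
    by (simp add: permanent_permutes prod_exc_weight)
  have "permanent exc_weight {..<Suc n} {..<Suc n} =
    (\<Sum>b\<in>insert n {..<n}. \<Sum>p | p permutes {..<n}. monom 1 (card (?X (Suc n) (transpose n b \<circ> p))))"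
    unfolding perm by (simp only: lessThan_Suc sum_over_permutations_insert[OF finite_lessThan, of n n] lessThan_iff less_irrefl not_False_eq_True)
  also have "\<dots> = (\<Sum>p | p permutes {..<n}. \<Sum>b\<in>insert n {..<n}. monom 1 (card (?X (Suc n) (transpose n b \<circ> p))))"
    by (rule sum.swap)
  also have "\<dots> = (\<Sum>p | p permutes {..<n}. eulerian_step n (monom 1 (card (?X n p))))"
  proof (rule sum.cong[OF refl], safe)
    fix p assume p: "p permutes {..<n}"
    have pn: "p n = n" using permutes_not_in[OF p] by simp
    have lt: "p i < n \<longleftrightarrow> i < n" for i using permutes_in_image[OF p] by simp
    have "?X (Suc n) (transpose n n \<circ> p) = ?X n p"
      using pn by (auto simp: less_Suc_eq)
    moreover have "card (?X (Suc n) (transpose n (p v) \<circ> p)) =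
        (if v \<in> ?X n p then card (?X n p) else Suc (card (?X n p)))" if "v < n" for v
    proof -
      have "?X (Suc n) (transpose n (p v) \<circ> p) = insert v (?X n p)"
      proof (rule set_eqI)
        fix i
        consider "i = v" | "i = n" | "i < n" "i \<noteq> v" | "i > n" by linarith
        then show "i \<in> ?X (Suc n) (transpose n (p v) \<circ> p) \<longleftrightarrow> i \<in> insert v (?X n p)"
        proof cases
          case 3
          then have "p i \<noteq> p v" "p i \<noteq> n"
            using permutes_inj[OF p] lt[of i] by (auto simp: inj_eq)
          then show ?thesis using 3 by (simp add: transpose_def)
        qed (use that lt[of v] pn in \<open>auto simp: transpose_def\<close>)
      qed
      then show ?thesis by (simp add: card_insert_if)
    qed
    moreover have "(\<Sum>b<n. monom 1 (card (?X (Suc n) (transpose n b \<circ> p)))) =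
      (\<Sum>v<n. monom 1 (card (?X (Suc n) (transpose n (p v) \<circ> p))) :: int poly)"
      by (subst sum.permute[OF p]) (simp add: o_def)
    ultimately show "(\<Sum>b\<in>insert n {..<n}. monom 1 (card (?X (Suc n) (transpose n b \<circ> p)))) =
      eulerian_step n (monom 1 (card (?X n p)))"
      by (subst eulerian_step_monom) auto
  qed
  also have "\<dots> = eulerian_step n (permanent exc_weight {..<n} {..<n})"
    by (simp add: perm eulerian_step_sum)
  finally show ?thesis .
qed

lemma permanent_exc_weight: "permanent exc_weight {..<n} {..<n} = eulerian_poly n"
proof (induction n)
  case 0
  show ?case by (simp add: permanent_permutes eulerian_poly_0)
next
  case (Suc n)
  then show ?case by (simp add: permanent_exc_weight_Suc eulerian_poly_Suc)
qed

definition weak_exc_weight :: "nat \<Rightarrow> nat \<Rightarrow> int poly" where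
  "weak_exc_weight i j = (if i \<le> j then monom 1 1 else 1)"

text \<open>
  Increase all values cyclically by one. Then weak excedances become excedances, with one exception:
  the position of the largest value \<open>m - 1\<close> is always a weak excedance, but its new value \<open>0\<close> makes
  it no excedance. This accounts for the additional factor t. For \<open>m = 0\<close> there is no such position.
\<close>

lemma permanent_weak_exc_weight:
  assumes m: "m > 0"
  shows "permanent weak_exc_weight {..<m} {..<m} = monom 1 1 * eulerian_poly m"
proof -
  define c where "c = (\<lambda>y. if y = m - 1 then 0 else Suc y)"
  have bij: "bij_betw c {..<m} {..<m}"
    by (rule bij_betw_byWitness[where f' = "\<lambda>y. if y = 0 then m - 1 else y - 1"])
      (use m in \<open>auto simp: c_def\<close>)
  have "monom 1 1 * eulerian_poly m = monom 1 1 * permanent exc_weight (id ` {..<m}) (c ` {..<m})"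
    using bij by (simp add: bij_betw_def permanent_exc_weight)
  also have "\<dots> = monom 1 1 * permanent (\<lambda>x y. exc_weight x (c y)) {..<m} {..<m}"
    using bij by (subst permanent_reindex) (auto simp: bij_betw_def)
  also have "\<dots> = (\<Sum>p | p permutes {..<m}. monom 1 1 * (\<Prod>x<m. exc_weight x (c (p x))))"
    by (simp add: permanent_permutes sum_distrib_left)
  also have "\<dots> = (\<Sum>p | p permutes {..<m}. \<Prod>x<m. weak_exc_weight x (p x))"
  proof (rule sum.cong[OF refl], safe)
    fix p assume p: "p permutes {..<m}"
    define z where "z = inv p (m - 1)"
    have pz: "p z = m - 1" by (simp add: z_def permutes_inverses[OF p])
    have z: "z < m" using permutes_in_image[OF p, of z] pz m by simp
    have "(\<Prod>x\<in>{..<m} - {z}. exc_weight x (c (p x))) = (\<Prod>x\<in>{..<m} - {z}. weak_exc_weight x (p x))"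
    proof (rule prod.cong[OF refl])
      fix x assume "x \<in> {..<m} - {z}"
      then have "p x \<noteq> m - 1" using pz permutes_inj[OF p] by (auto simp: inj_def)
      then show "exc_weight x (c (p x)) = weak_exc_weight x (p x)"
        by (auto simp: exc_weight_def weak_exc_weight_def c_def)
    qed
    moreover have "exc_weight z (c (p z)) = 1" "weak_exc_weight z (p z) = monom 1 1"
      using z by (auto simp: pz c_def exc_weight_def weak_exc_weight_def)
    ultimately show "monom 1 1 * (\<Prod>x<m. exc_weight x (c (p x))) = (\<Prod>x<m. weak_exc_weight x (p x))"
      using z by (simp add: prod.remove[of "{..<m}" z])
  qed
  also have "\<dots> = permanent weak_exc_weight {..<m} {..<m}"
    by (simp add: permanent_permutes)
  finally show ?thesis by simp
qed

section \<open>Blocks of residue classes\<close>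

lemma block_less_iff:
  assumes "c < k" "d < (k::nat)"
  shows "c + k * x < d + k * y \<longleftrightarrow> x < y \<or> x = y \<and> c < d"
proof -
  have "c + k * x < d + k * y" if "x < y"
    using mult_le_mono2[of "Suc x" y k] that assms by simp
  moreover have "d + k * y < c + k * x" if "y < x"
    using mult_le_mono2[of "Suc y" x k] that assms by simp
  ultimately show ?thesis by (cases x y rule: linorder_cases) auto
qed

text \<open>
  Starting at 0 instead of 1 makes \<open>x\<close> and \<open>c\<close> quotient and remainder. The incomplete last
  period of length \<open>j\<close> adds one element to each of the classes \<open>c < j\<close>.
\<close>

lemma residue_class_eq_image:
  assumes "c < k" "j \<le> k"
  shows "{i \<in> {..<m * k + j}. i mod k = c} = (\<lambda>x. c + k * x) ` {..<if c < j then Suc m else m}"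
proof -
  have iff: "c + k * x < m * k + j \<longleftrightarrow> x < (if c < j then Suc m else m)" for x
  proof (cases "j = k")
    case True
    then show ?thesis using block_less_iff[of c k 0 x "Suc m"] assms by (simp add: mult.commute add.commute)
  next
    case False
    then show ?thesis using block_less_iff[of c k j x m] assms by (auto simp: mult.commute add.commute)
  qed
  show ?thesis
  proof (intro equalityI subsetI)
    fix i assume i: "i \<in> {i \<in> {..<m * k + j}. i mod k = c}"
    then have eq: "i = c + k * (i div k)" by auto
    moreover from i have "c + k * (i div k) < m * k + j" using eq by simp
    then have "i div k < (if c < j then Suc m else m)" by (simp only: iff)
    ultimately show "i \<in> (\<lambda>x. c + k * x) ` {..<if c < j then Suc m else m}" by blast
  next
    fix i assume "i \<in> (\<lambda>x. c + k * x) ` {..<if c < j then Suc m else m}"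
    then obtain x where "i = c + k * x" "x < (if c < j then Suc m else m)" by auto
    then show "i \<in> {i \<in> {..<m * k + j}. i mod k = c}"
      using assms(1) by (simp only: iff mem_Collect_eq lessThan_iff) simp
  qed
qed

text \<open>
  Comparing \<open>c + k x\<close> with \<open>d + k y\<close> means comparing the indices \<open>x\<close> and \<open>y\<close>, and only a tie is
  decided by the offsets \<open>c\<close> and \<open>d\<close>.
\<close>

lemma permanent_exc_weight_progressions:
  assumes "c < k" "d < k" and N: "d \<le> c \<or> N > 0"
  shows "permanent exc_weight ((\<lambda>x. c + k * x) ` {..<N}) ((\<lambda>y. d + k * y) ` {..<N}) =
    (if c < d then monom 1 1 * eulerian_poly N else eulerian_poly N)"
proof -
  have "permanent exc_weight ((\<lambda>x. c + k * x) ` {..<N}) ((\<lambda>y. d + k * y) ` {..<N}) =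
    permanent (\<lambda>x y. exc_weight (c + k * x) (d + k * y)) {..<N} {..<N}"
    using assms by (intro permanent_reindex inj_onI) auto
  also have "\<dots> = permanent (if c < d then weak_exc_weight else exc_weight) {..<N} {..<N}"
    using assms by (intro permanent_cong refl)
      (auto simp: exc_weight_def weak_exc_weight_def block_less_iff)
  also have "\<dots> = (if c < d then monom 1 1 * eulerian_poly N else eulerian_poly N)"
    using N by (auto simp: permanent_exc_weight permanent_weak_exc_weight)
  finally show ?thesis .
qed

text \<open>
  Position \<open>n\<close> cannot be an excedance, so it may be counted among the candidates; this gives every
  row of the matrix a weight.
\<close>

lemma exc_eq_card: "p permutes {1..n} \<Longrightarrow> exc n p = card {i \<in> {1..n}. i < p i}"
proof -
  assume p: "p permutes {1..n}"
  have "i \<le> n - 1" if "1 \<le> i" "i \<le> n" "i < p i" for i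
  proof -
    have "p i \<in> {1..n}" using permutes_in_image[OF p, of i] that by simp
    then show ?thesis using that by simp
  qed
  then have "{i \<in> {1..n - 1}. i < p i} = {i \<in> {1..n}. i < p i}" by fastforce
  then show "exc n p = card {i \<in> {1..n}. i < p i}" by (simp add: exc_def)
qed

lemma shift_cong_iff:
  "[int (Suc y) - int (Suc x) = int (Suc s) - 1] (mod int k) \<longleftrightarrow> (x + s) mod k = y mod k"
proof -
  have "[int (Suc y) - int (Suc x) = int (Suc s) - 1] (mod int k) \<longleftrightarrow> [int y = int (x + s)] (mod int k)"
    by (simp add: cong_iff_dvd_diff algebra_simps)
  also have "\<dots> \<longleftrightarrow> y mod k = (x + s) mod k" by (simp only: cong_int_iff) (simp only: cong_def)
  finally show ?thesis by auto
qed

text \<open>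
  Vanishing entries encode the congruence: a permutation that violates it contributes 0 to the
  permanent. Position \<open>i + 1\<close> and value \<open>j + 1\<close> are renamed to \<open>i\<close> and \<open>j\<close>, which preserves
  excedances and differences. Each block is named after the residue of its columns.
\<close>

lemma MPE_shift_eq_prod_permanent:
  assumes k: "k > 0"
  shows "MPE_shift k n (Suc s) = (\<Prod>d<k. permanent exc_weight
    {i \<in> {..<n}. (i + s) mod k = d} {j \<in> {..<n}. j mod k = d})"
proof -
  let ?cong = "\<lambda>i j. [int j - int i = int (Suc s) - 1] (mod int k)"
  define w where "w = (\<lambda>i j. if ?cong i j then exc_weight i j else 0)"
  have "MPE_shift k n (Suc s) = (\<Sum>p | p permutes {1..n}. \<Prod>i\<in>{1..n}. w i (p i))"
    unfolding MPE_shift_def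
  proof (rule sum.mono_neutral_cong_left)
    show "finite {p. p permutes {1..n}}" by (simp add: finite_permutations)
    show "MP_shift k n (Suc s) \<subseteq> {p. p permutes {1..n}}" by (auto simp: MP_shift_def)
    show "\<forall>p\<in>{p. p permutes {1..n}} - MP_shift k n (Suc s). (\<Prod>i\<in>{1..n}. w i (p i)) = 0"
      unfolding MP_shift_def w_def by (auto intro!: prod_zero)
    fix p assume p: "p \<in> MP_shift k n (Suc s)"
    then have "(\<Prod>i\<in>{1..n}. w i (p i)) = (\<Prod>i\<in>{1..n}. exc_weight i (p i))"
      by (intro prod.cong) (auto simp: MP_shift_def w_def)
    then show "monom 1 (exc n p) = (\<Prod>i\<in>{1..n}. w i (p i))"
      using p by (simp add: prod_exc_weight exc_eq_card MP_shift_def)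
  qed
  also have "\<dots> = permanent w (Suc ` {..<n}) (Suc ` {..<n})"
    by (simp add: permanent_permutes image_Suc_lessThan)
  also have "\<dots> = permanent (\<lambda>x y. w (Suc x) (Suc y)) {..<n} {..<n}"
    by (intro permanent_reindex) auto
  also have "\<dots> = (\<Prod>d<k. permanent (\<lambda>x y. w (Suc x) (Suc y))
      {i \<in> {..<n}. (i + s) mod k = d} {j \<in> {..<n}. j mod k = d})"
    unfolding w_def shift_cong_iff using k by (intro permanent_blocks) auto
  also have "\<dots> = (\<Prod>d<k. permanent exc_weight
      {i \<in> {..<n}. (i + s) mod k = d} {j \<in> {..<n}. j mod k = d})"
    unfolding w_def shift_cong_iff
    by (intro prod.cong permanent_cong refl) (auto simp: exc_weight_def)
  finally show ?thesis .
qed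

lemma MPE_eq_MPE_shift_1: "MPE k n = MPE_shift k n 1"
proof -
  have "[int a - int b = int 1 - 1] (mod int k) \<longleftrightarrow> [a = b] (mod k)" for a b
  proof -
    have "[int a - int b = int 1 - 1] (mod int k) \<longleftrightarrow> [int a = int b] (mod int k)"
      by (simp add: cong_iff_dvd_diff)
    then show ?thesis by (simp only: cong_int_iff)
  qed
  then show ?thesis
    by (simp add: MPE_def MPE_shift_def mod_alternating_def MP_shift_def)
qed

section \<open>The generating functions\<close>

text \<open>
  Rows and columns of each block form the same residue class, so every block counts excedances.
\<close>

lemma MPE_shift_1:
  assumes k: "k > 0" and j: "j \<le> k"
  shows "MPE_shift k (m * k + j) 1 = eulerian_poly (m + 1) ^ j * eulerian_poly m ^ (k - j)"
proof -
  have "MPE_shift k (m * k + j) 1 = (\<Prod>d<k. if d < j then eulerian_poly (Suc m) else eulerian_poly m)"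
    unfolding One_nat_def MPE_shift_eq_prod_permanent[OF k]
  proof (rule prod.cong[OF refl])
    fix d assume "d \<in> {..<k}"
    then have d: "d < k" by simp
    show "permanent exc_weight {i \<in> {..<m * k + j}. (i + 0) mod k = d}
        {i \<in> {..<m * k + j}. i mod k = d} =
      (if d < j then eulerian_poly (Suc m) else eulerian_poly m)"
      unfolding add_0_right residue_class_eq_image[OF d j]
      by (simp add: permanent_exc_weight_progressions[OF d d])
  qed
  also have "\<dots> = eulerian_poly (Suc m) ^ card ({..<k} \<inter> {d. d < j}) *
      eulerian_poly m ^ card ({..<k} \<inter> - {d. d < j})"
    by (simp add: prod.If_cases)
  also have "{..<k} \<inter> {d. d < j} = {..<j}" using j by auto
  also have "{..<k} \<inter> - {d. d < j} = {j..<k}" by auto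
  finally show ?thesis by simp
qed

lemma mod_shift_eq_iff:
  assumes "s < k" "d < (k::nat)"
  shows "(i + s) mod k = d \<longleftrightarrow> i mod k = (if s \<le> d then d - s else d + k - s)"
proof -
  define u where "u = i mod k"
  have u: "u < k" using assms by (simp add: u_def)
  have "(i + s) mod k = (u + s) mod k" by (simp add: u_def mod_add_left_eq)
  also have "\<dots> = (if u + s < k then u + s else u + s - k)"
    using u assms by (auto simp: le_mod_geq not_less)
  finally have "(i + s) mod k = d \<longleftrightarrow> u = (if s \<le> d then d - s else d + k - s)"
    using u assms by (auto split: if_splits)
  then show ?thesis by (simp only: u_def)
qed

text \<open>
  The block with columns of residue \<open>d\<close> has rows of residue \<open>d - s\<close> modulo \<open>k\<close>. This residue is
  smaller than \<open>d\<close> exactly if \<open>d \<ge> s\<close>, since otherwise the subtraction wraps around; so \<open>k - s\<close>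
  blocks count weak excedances. All blocks are square because \<open>k\<close> divides the length.
\<close>

lemma MPE_shift_multiple:
  assumes s: "0 < s" "s < k" and m: "m > 0"
  shows "MPE_shift k (m * k) (Suc s) = monom 1 (k - s) * eulerian_poly m ^ k"
proof -
  have k: "k > 0" using s by simp
  have "MPE_shift k (m * k) (Suc s) =
      (\<Prod>d<k. (if s \<le> d then monom 1 1 else 1) * eulerian_poly m)"
    unfolding MPE_shift_eq_prod_permanent[OF k]
  proof (rule prod.cong[OF refl])
    fix d assume "d \<in> {..<k}"
    then have d: "d < k" by simp
    define c where "c = (if s \<le> d then d - s else d + k - s)"
    have c: "c < k" "c < d \<longleftrightarrow> s \<le> d" using s d by (auto simp: c_def)
    have "permanent exc_weight {i \<in> {..<m * k}. (i + s) mod k = d} {j \<in> {..<m * k}. j mod k = d} =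
      permanent exc_weight ((\<lambda>x. c + k * x) ` {..<m}) ((\<lambda>y. d + k * y) ` {..<m})"
      using residue_class_eq_image[of _ k 0 m] c(1) d
      by (simp add: mod_shift_eq_iff[OF s(2) d] flip: c_def)
    also have "\<dots> = (if s \<le> d then monom 1 1 else 1) * eulerian_poly m"
      using permanent_exc_weight_progressions[OF c(1) d] m c(2) by simp
    finally show "permanent exc_weight {i \<in> {..<m * k}. (i + s) mod k = d}
        {j \<in> {..<m * k}. j mod k = d} = (if s \<le> d then monom 1 1 else 1) * eulerian_poly m" .
  qed
  also have "\<dots> = monom 1 1 ^ card ({..<k} \<inter> {d. s \<le> d}) * eulerian_poly m ^ k"
    by (simp add: prod.distrib prod.If_cases)
  also have "{..<k} \<inter> {d. s \<le> d} = {s..<k}" by auto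
  finally show ?thesis by (simp add: monom_power)
qed

theorem theorem2p1:
  fixes n k :: nat
  assumes "n > 0" and "k > 0"
  shows "(\<forall>m j. n = m * k + j \<and> 1 \<le> j \<and> j \<le> k - 1 \<longrightarrow>
            MPE k n = MPE_shift k n 1 \<and>
            MPE_shift k n 1 = eulerian_poly (m + 1) ^ j * eulerian_poly m ^ (k - j))
       \<and> (\<forall>m r. n = m * k \<and> 1 \<le> r \<and> r \<le> k \<longrightarrow>
            MPE_shift k n r =
              (if r = 1 then eulerian_poly m ^ k
               else monom 1 (k + 1 - r) * eulerian_poly m ^ k))"
proof (intro conjI allI impI)
  fix m j assume mj: "n = m * k + j \<and> 1 \<le> j \<and> j \<le> k - 1"
  show "MPE k n = MPE_shift k n 1" by (rule MPE_eq_MPE_shift_1)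
  have "j \<le> k" "n = m * k + j" using mj by linarith+
  then show "MPE_shift k n 1 = eulerian_poly (m + 1) ^ j * eulerian_poly m ^ (k - j)"
    by (simp only: MPE_shift_1[OF \<open>k > 0\<close>])
next
  fix m r assume mr: "n = m * k \<and> 1 \<le> r \<and> r \<le> k"
  show "MPE_shift k n r = (if r = 1 then eulerian_poly m ^ k
    else monom 1 (k + 1 - r) * eulerian_poly m ^ k)"
  proof (cases "r = 1")
    case True
    then show ?thesis using mr MPE_shift_1[OF \<open>k > 0\<close>, of 0 m] by simp
  next
    case False
    define s where "s = r - 1"
    have s: "r = Suc s" "0 < s" "s < k" using mr False by (auto simp: s_def)
    have "m > 0" using mr \<open>n > 0\<close> by (cases m) auto
    then show ?thesis using MPE_shift_multiple[OF s(2,3)] mr s by simp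
  qed
qed

end
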